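(* Let $M^2$ be a meridian surface in the Euclidean space $\mathbb{E}^4$, parametrized by $z(u,v)=f(u)\,r(v)+g(u)\,e_4$, $u\in I$, $v\in J$. The Gauss map $G$ of $M^2$ is harmonic, i.e. $\Delta G=0$, if and only if $M^2$ is part of a plane (a 2-dimensional affine plane in $\mathbb{E}^4$).
   Context: Meridian surface: Let $\{e_1,e_2,e_3,e_4\}$ be the standard orthonormal frame in $\mathbb{E}^4$ and $S^2(1)$ the unit 2-sphere centered at the origin in $\mathbb{E}^3=\mathrm{span}\{e_1,e_2,e_3\}$. Let $c: r=r(v)$, $v\in J$ ($J\subset\mathbb{R}$ an interval), be a smooth curve on $S^2(1)$ parametrized by arc length. Let $f=f(u)$, $g=g(u)$ be non-zero smooth functions on an interval $I\subset\mathbb{R}$ with $f'(u)^2+g'(u)^2=1$ for all $u\in I$ and with $f$ nowhere vanishing (so that $z$ below is an immersion). The meridian surface $M^2$ is the immersed surface $z(u,v)=f(u)\,r(v)+g(u)\,e_4$, $u\in I$, $v\in J$, with the induced metric $du^2+f(u)^2dv^2$. Gauss map: with $x=z_u$ and $y=z_v/f=r'(v)$, which form an orthonormal tangent frame, the Gauss map is $G=x\wedge y$, regarded as a map into the vector space $\wedge^2\mathbb{E}^4\cong\mathbb{E}^6$. Laplacian: $\Delta\phi=-\sum_i\left(\nabla'_{\epsilon_i}\nabla'_{\epsilon_i}\phi-\nabla'_{\nabla_{\epsilon_i}\epsilon_i}\phi\right)$ for a local orthonormal tangent frame $\{\epsilon_1,\epsilon_2\}$, where $\nabla$ is the Levi-Civita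 connection of $M^2$ and $\nabla'$ is the flat derivative of the ambient space; it is applied componentwise to vector-valued maps such as $G$. *)

theory Defs
  imports "HOL-Analysis.Analysis"
begin

text \<open>Smoothness on an arbitrary nondegenerate interval; derivatives at endpoints belonging to
  the interval are one-sided.\<close>

definition smooth_on_interval :: "(real \<Rightarrow> 'a::real_normed_vector) \<Rightarrow> real set \<Rightarrow> bool" where
  "smooth_on_interval h I \<longleftrightarrow>
     (\<exists>d :: nat \<Rightarrow> real \<Rightarrow> 'a. d 0 = h \<and>
        (\<forall>n. \<forall>t\<in>I. (d n has_vector_derivative d (Suc n) t) (at t within I)))"

text \<open>In this theory a parametrized surface is a map \<open>z\<close> from \<open>D \<subseteq> \<real>\<^sup>2\<close> to a Euclidean
  space. Tangent vector fields are given by their components \<open>X p $ i\<close> with respect to the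
  coordinate fields, and \<open>dir_deriv D X \<phi>\<close> is the flat derivative of a vector-valued function
  \<open>\<phi>\<close> along \<open>X\<close>; in particular \<open>dir_deriv D X z\<close> is \<open>X\<close> as a field of vectors in the ambient
  space.\<close>

definition partial_deriv ::
    "(real^2) set \<Rightarrow> 2 \<Rightarrow> (real^2 \<Rightarrow> 'a::real_normed_vector) \<Rightarrow> real^2 \<Rightarrow> 'a" where
  "partial_deriv D i \<phi> p =
     vector_derivative (\<lambda>t. \<phi> (p + t *\<^sub>R axis i 1)) (at 0 within {t. p + t *\<^sub>R axis i 1 \<in> D})"

definition dir_deriv ::
    "(real^2) set \<Rightarrow> (real^2 \<Rightarrow> real^2) \<Rightarrow> (real^2 \<Rightarrow> 'a::real_normed_vector) \<Rightarrow> real^2 \<Rightarrow> 'a" where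
  "dir_deriv D X \<phi> p = (\<Sum>i\<in>UNIV. X p $ i *\<^sub>R partial_deriv D i \<phi> p)"

definition induced_metric ::
    "(real^2) set \<Rightarrow> (real^2 \<Rightarrow> 'a::real_inner) \<Rightarrow> real^2 \<Rightarrow> real^2^2" where
  "induced_metric D z p = (\<chi> i j. inner (partial_deriv D i z p) (partial_deriv D j z p))"

definition christoffel ::
    "(real^2) set \<Rightarrow> (real^2 \<Rightarrow> 'a::real_inner) \<Rightarrow> 2 \<Rightarrow> 2 \<Rightarrow> 2 \<Rightarrow> real^2 \<Rightarrow> real" where
  "christoffel D z k i j p =
     (1/2) * (\<Sum>l\<in>UNIV. matrix_inv (induced_metric D z p) $ k $ l *
       (partial_deriv D i (\<lambda>q. induced_metric D z q $ j $ l) p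
        + partial_deriv D j (\<lambda>q. induced_metric D z q $ i $ l) p
        - partial_deriv D l (\<lambda>q. induced_metric D z q $ i $ j) p))"

text \<open>The Levi-Civita connection of the induced metric, \<open>\<nabla>\<^sub>X Y\<close>.\<close>

definition levi_civita ::
    "(real^2) set \<Rightarrow> (real^2 \<Rightarrow> 'a::real_inner) \<Rightarrow> (real^2 \<Rightarrow> real^2) \<Rightarrow> (real^2 \<Rightarrow> real^2)
       \<Rightarrow> real^2 \<Rightarrow> real^2" where
  "levi_civita D z X Y p =
     (\<chi> k. dir_deriv D X (\<lambda>q. Y q $ k) p
            + (\<Sum>i\<in>UNIV. \<Sum>j\<in>UNIV. christoffel D z k i j p * X p $ i * Y p $ j))"

text \<open>Differentiability is all the regularity of the frame that the Laplacian below uses, so smooth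
  frames are included.\<close>

definition orthonormal_frame ::
    "(real^2) set \<Rightarrow> (real^2 \<Rightarrow> 'a::real_inner) \<Rightarrow> (2 \<Rightarrow> real^2 \<Rightarrow> real^2) \<Rightarrow> bool" where
  "orthonormal_frame D z \<epsilon> \<longleftrightarrow>
     (\<forall>i. \<epsilon> i differentiable_on D) \<and>
     (\<forall>p\<in>D. \<forall>i j. inner (dir_deriv D (\<epsilon> i) z p) (dir_deriv D (\<epsilon> j) z p)
                     = (if i = j then 1 else 0))"

definition laplacian ::
    "(real^2) set \<Rightarrow> (real^2 \<Rightarrow> 'a::real_inner) \<Rightarrow> (2 \<Rightarrow> real^2 \<Rightarrow> real^2)
       \<Rightarrow> (real^2 \<Rightarrow> 'b::real_normed_vector) \<Rightarrow> real^2 \<Rightarrow> 'b" where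
  "laplacian D z \<epsilon> \<phi> p =
     - (\<Sum>i\<in>UNIV. dir_deriv D (\<epsilon> i) (dir_deriv D (\<epsilon> i) \<phi>) p
                  - dir_deriv D (levi_civita D z (\<epsilon> i) (\<epsilon> i)) \<phi> p)"

text \<open>The exterior square of \<open>\<real>\<^sup>4\<close>, identified with \<open>\<real>\<^sup>6\<close> through the orthonormal basis
  \<open>e\<^sub>i \<and> e\<^sub>j\<close>, \<open>i < j\<close>, in lexicographic order.\<close>

definition wedge :: "real^4 \<Rightarrow> real^4 \<Rightarrow> real^6" where
  "wedge a b = vector
     [a$1 * b$2 - a$2 * b$1, a$1 * b$3 - a$3 * b$1, a$1 * b$4 - a$4 * b$1,
      a$2 * b$3 - a$3 * b$2, a$2 * b$4 - a$4 * b$2, a$3 * b$4 - a$4 * b$3]"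

lemma UNIV_6: "(UNIV :: 6 set) = {1, 2, 3, 4, 5, 6}"
proof (rule card_subset_eq [symmetric])
  show "card {1, 2, 3, 4, 5, 6 :: 6} = card (UNIV :: 6 set)"
    by simp
qed simp_all

lemma sum_6: "sum h (UNIV :: 6 set) = h 1 + h 2 + h 3 + h 4 + h 5 + h 6"
  unfolding UNIV_6 by (simp add: ac_simps)

lemma wedge_nth:
  "wedge a b $ 1 = a$1 * b$2 - a$2 * b$1" "wedge a b $ 2 = a$1 * b$3 - a$3 * b$1"
  "wedge a b $ 3 = a$1 * b$4 - a$4 * b$1" "wedge a b $ 4 = a$2 * b$3 - a$3 * b$2"
  "wedge a b $ 5 = a$2 * b$4 - a$4 * b$2" "wedge a b $ 6 = a$3 * b$4 - a$4 * b$3"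
  by (simp_all add: wedge_def vector_def)

lemma inner_wedge:
  "inner (wedge a b) (wedge c d) = inner a c * inner b d - inner a d * inner b c"
  unfolding inner_vec_def sum_6 wedge_nth sum_4 inner_real_def by algebra

definition param_domain :: "real set \<Rightarrow> real set \<Rightarrow> (real^2) set" where
  "param_domain I J = {p. p $ 1 \<in> I \<and> p $ 2 \<in> J}"

definition meridian_surface ::
    "(real \<Rightarrow> real) \<Rightarrow> (real \<Rightarrow> real) \<Rightarrow> (real \<Rightarrow> real^4) \<Rightarrow> real^2 \<Rightarrow> real^4" where
  "meridian_surface f g r p = f (p $ 1) *\<^sub>R r (p $ 2) + g (p $ 1) *\<^sub>R axis 4 1"

definition gauss_map ::
    "real set \<Rightarrow> real set \<Rightarrow> (real \<Rightarrow> real) \<Rightarrow> (real \<Rightarrow> real) \<Rightarrow> (real \<Rightarrow> real^4)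
       \<Rightarrow> real^2 \<Rightarrow> real^6" where
  "gauss_map I J f g r p =
     wedge (partial_deriv (param_domain I J) 1 (meridian_surface f g r) p)
           ((1 / f (p $ 1)) *\<^sub>R partial_deriv (param_domain I J) 2 (meridian_surface f g r) p)"

end

theory Submission
  imports Defs
begin

text \<open>
  The Gauss map \<open>G = x \<and> y\<close> has constant length \<open>1\<close>, and a harmonic map of constant length has zero
  derivative. Indeed \<open>\<langle>G, D\<^sub>X G\<rangle> = 0\<close> for every tangent field \<open>X\<close>; differentiating this along \<open>X\<close>
  gives \<open>\<langle>G, D\<^sub>X D\<^sub>X G\<rangle> = - \<bar>D\<^sub>X G\<bar>\<^sup>2\<close>. The connection term of the Laplacian is itself a first
  derivative of \<open>G\<close>, hence orthogonal to \<open>G\<close>, and therefore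
  \<open>\<langle>G, \<Delta>G\<rangle> = \<bar>D G\<bar>\<^sup>2\<close>, the sum of the squared derivatives over the orthonormal frame
  (\<open>harmonic_constant_length_imp_partial_derivs_zero\<close>). So \<open>\<Delta>G = 0\<close> forces \<open>G\<close> to be constant on
  the parameter rectangle.

  A surface with constant Gauss map is planar (\<open>planar_if_wedge_constant\<close>): the bivector \<open>x \<and> y\<close>
  determines the plane spanned by \<open>x\<close> and \<open>y\<close>, so a vector \<open>w\<close> orthogonal to one tangent plane is
  orthogonal to all of them, and \<open>\<langle>w, z\<rangle>\<close> is constant.

  Conversely, let \<open>z\<close> lie in a plane with direction space \<open>V\<close>. Then \<open>x\<close>, \<open>y\<close> and their derivatives
  lie in \<open>V = span {x, y}\<close>. As \<open>x\<close> has constant length, its derivatives are multiples of \<open>y\<close>, and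
  those of \<open>y\<close> are multiples of \<open>x\<close>; both terms of the product rule for \<open>x \<and> y\<close> vanish
  (\<open>wedge_partial_derivs_zero_in_plane\<close>). With all first derivatives zero, the Laplacian is zero.

  For a meridian surface the orthonormal tangent frame is \<open>x = z\<^sub>u = f' r + g' e\<^sub>4\<close>, \<open>y = r'\<close>. So \<open>G\<close>
  is a sum of products of smooth functions of \<open>u\<close> and smooth functions of \<open>v\<close>, which provides the
  second partial derivatives that the argument uses.
\<close>

section \<open>Partial derivatives along coordinate slices\<close>

text \<open>The function \<open>partial_deriv\<close> is total, so it says nothing about whether the derivative
  exists. The predicate \<open>has_partial_deriv\<close> below carries existence and value together; the two
  agree where \<open>0\<close> is a limit point of the slices (\<open>nondegenerate\<close>), since only there is the
  one-variable derivative unique.\<close>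

definition slice :: "(real^2) set \<Rightarrow> 2 \<Rightarrow> real^2 \<Rightarrow> real set" where
  "slice D i p = {t. p + t *\<^sub>R axis i 1 \<in> D}"

definition has_partial_deriv ::
    "(real^2) set \<Rightarrow> 2 \<Rightarrow> (real^2 \<Rightarrow> 'a::real_normed_vector) \<Rightarrow> 'a \<Rightarrow> real^2 \<Rightarrow> bool" where
  "has_partial_deriv D i \<phi> \<phi>' p \<longleftrightarrow>
     ((\<lambda>t. \<phi> (p + t *\<^sub>R axis i 1)) has_vector_derivative \<phi>') (at 0 within slice D i p)"

definition nondegenerate :: "(real^2) set \<Rightarrow> bool" where
  "nondegenerate D \<longleftrightarrow> (\<forall>p\<in>D. \<forall>i. at 0 within slice D i p \<noteq> bot)"

lemma zero_in_slice: "p \<in> D \<Longrightarrow> 0 \<in> slice D i p"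
  by (simp add: slice_def)

lemma partial_deriv_eq:
  assumes "nondegenerate D" "p \<in> D" "has_partial_deriv D i \<phi> \<phi>' p"
  shows "partial_deriv D i \<phi> p = \<phi>'"
  using assms vector_derivative_within
  unfolding partial_deriv_def nondegenerate_def has_partial_deriv_def slice_def by blast

lemma has_partial_deriv_unique:
  assumes "nondegenerate D" "p \<in> D" "has_partial_deriv D i \<phi> a p" "has_partial_deriv D i \<phi> b p"
  shows "a = b"
  using assms partial_deriv_eq by metis

lemma has_partial_deriv_cong:
  assumes "p \<in> D" "\<And>q. q \<in> D \<Longrightarrow> \<psi> q = \<phi> q" "has_partial_deriv D i \<phi> \<phi>' p"
  shows "has_partial_deriv D i \<psi> \<phi>' p"
  using assms(3) unfolding has_partial_deriv_def
  by (rule has_vector_derivative_transform[rotated 2])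
     (use assms in \<open>auto simp: slice_def\<close>)

lemma has_partial_deriv_const: "has_partial_deriv D i (\<lambda>q. c) 0 p"
  by (simp add: has_partial_deriv_def)

lemma has_partial_deriv_add:
  assumes "has_partial_deriv D i \<phi> a p" "has_partial_deriv D i \<psi> b p"
  shows "has_partial_deriv D i (\<lambda>q. \<phi> q + \<psi> q) (a + b) p"
  using assms unfolding has_partial_deriv_def by (rule has_vector_derivative_add)

lemma has_partial_deriv_bilinear:
  assumes "bounded_bilinear h" "has_partial_deriv D i \<phi> a p" "has_partial_deriv D i \<psi> b p"
  shows "has_partial_deriv D i (\<lambda>q. h (\<phi> q) (\<psi> q)) (h (\<phi> p) b + h a (\<psi> p)) p"
  using bounded_bilinear.has_vector_derivative[OF assms(1) assms(2,3)[unfolded has_partial_deriv_def]]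
  by (simp add: has_partial_deriv_def)

lemmas has_partial_deriv_inner = has_partial_deriv_bilinear[OF bounded_bilinear_inner]
lemmas has_partial_deriv_scaleR = has_partial_deriv_bilinear[OF bounded_bilinear_scaleR]

lemma has_partial_deriv_linear:
  assumes "bounded_linear h" "has_partial_deriv D i \<phi> a p"
  shows "has_partial_deriv D i (\<lambda>q. h (\<phi> q)) (h a) p"
  using bounded_linear.has_vector_derivative[OF assms(1) assms(2)[unfolded has_partial_deriv_def]]
  by (simp add: has_partial_deriv_def)

lemma has_partial_deriv_of_derivative:
  assumes "p \<in> D" "(\<phi> has_derivative \<phi>') (at p within D)"
  shows "has_partial_deriv D i \<phi> (\<phi>' (axis i 1)) p"
proof -
  have "((\<lambda>t. p + t *\<^sub>R axis i 1) has_derivative (\<lambda>t. t *\<^sub>R axis i 1)) (at 0 within slice D i p)"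
    by (auto intro!: derivative_eq_intros)
  moreover have "(\<phi> has_derivative \<phi>') (at (p + 0 *\<^sub>R axis i 1)
      within (\<lambda>t. p + t *\<^sub>R axis i 1) ` slice D i p)"
    by (auto intro!: has_derivative_subset[OF assms(2)] simp: slice_def)
  ultimately have "((\<lambda>t. \<phi> (p + t *\<^sub>R axis i 1)) has_derivative (\<lambda>t. \<phi>' (t *\<^sub>R axis i 1)))
      (at 0 within slice D i p)"
    by (rule has_derivative_in_compose)
  then show ?thesis
    using linear_cmul[OF has_derivative_linear[OF assms(2)]]
    by (simp add: has_partial_deriv_def has_vector_derivative_def)
qed

lemma has_vector_derivative_translate:
  fixes h :: "real \<Rightarrow> 'a::real_normed_vector"
  assumes "(h has_vector_derivative h') (at (c + a) within S)"
  shows "((\<lambda>t. h (c + t)) has_vector_derivative h') (at a within {t. c + t \<in> S})"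
proof -
  have "((\<lambda>t. c + t) has_vector_derivative 1) (at a within {t. c + t \<in> S})"
    by (auto intro!: derivative_eq_intros)
  moreover have "(h has_vector_derivative h') (at (c + a) within (+) c ` {t. c + t \<in> S})"
    by (rule has_vector_derivative_within_subset[OF assms]) auto
  ultimately show ?thesis
    using vector_diff_chain_within by (fastforce simp: o_def)
qed

text \<open>Partial derivatives are taken at parameter \<open>0\<close> of the slice through the point itself. Re-basing
  the slice at a fixed point \<open>p\<close> turns them into the derivative of one function of one real variable
  at all of its arguments, as the mean value theorem requires.\<close>
lemma has_partial_deriv_along_slice:
  assumes "has_partial_deriv D i \<phi> \<phi>' (p + t *\<^sub>R axis i 1)"
  shows "((\<lambda>s. \<phi> (p + s *\<^sub>R axis i 1)) has_vector_derivative \<phi>') (at t within slice D i p)"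
proof -
  have "((\<lambda>s. \<phi> (p + t *\<^sub>R axis i 1 + (- t + s) *\<^sub>R axis i 1)) has_vector_derivative \<phi>')
      (at t within {s. - t + s \<in> slice D i (p + t *\<^sub>R axis i 1)})"
    by (rule has_vector_derivative_translate) (use assms in \<open>simp add: has_partial_deriv_def\<close>)
  then show ?thesis by (simp add: slice_def algebra_simps)
qed

text \<open>A vector \<open>w\<close> orthogonal to \<open>V\<close> satisfies \<open>\<langle>w, \<phi>\<rangle> = 0\<close>, hence \<open>\<langle>w, \<phi>'\<rangle> = 0\<close>; apply this to the
  component of \<open>\<phi>'\<close> orthogonal to \<open>V\<close>.\<close>
lemma has_partial_deriv_in_subspace:
  fixes \<phi> :: "real^2 \<Rightarrow> 'a::euclidean_space"
  assumes "nondegenerate D" "p \<in> D" "subspace V"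
    and "\<And>q. q \<in> D \<Longrightarrow> \<phi> q \<in> V" "has_partial_deriv D i \<phi> \<phi>' p"
  shows "\<phi>' \<in> V"
proof -
  obtain a w where a: "a \<in> span V" and w: "\<And>v. v \<in> span V \<Longrightarrow> orthogonal w v"
    and split: "\<phi>' = a + w"
    by (rule orthogonal_subspace_decomp_exists[of V \<phi>']) blast
  have V: "span V = V" using assms(3) by (rule span_eq_iff[THEN iffD2])
  have "inner w (\<phi> q) = 0" if "q \<in> D" for q
    using w[of "\<phi> q"] assms(4)[OF that] by (simp add: V orthogonal_def)
  then have "inner w \<phi>' = 0"
    using has_partial_deriv_unique[OF assms(1,2)
        has_partial_deriv_linear[OF bounded_linear_inner_right assms(5)]
        has_partial_deriv_cong[OF assms(2) _ has_partial_deriv_const]] by blast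
  moreover have "inner w a = 0" using w[OF a] by (simp add: orthogonal_def)
  ultimately have "w = 0" by (simp add: split inner_add_right)
  then show ?thesis using a split V by simp
qed

section \<open>Rectangles\<close>

definition coord_interval :: "real set \<Rightarrow> real set \<Rightarrow> 2 \<Rightarrow> real set" where
  "coord_interval I J i = (if i = 1 then I else J)"

lemma slice_param_domain:
  assumes "p \<in> param_domain I J"
  shows "slice (param_domain I J) i p = {t. p $ i + t \<in> coord_interval I J i}"
  using assms exhaust_2[of i] by (auto simp: slice_def param_domain_def coord_interval_def axis_def)

lemma at_within_interval_neq_bot:
  fixes S :: "real set"
  assumes "is_interval S" "interior S \<noteq> {}" "x \<in> S"
  shows "at x within S \<noteq> bot"
proof -
  have "S \<noteq> {y}" for y using assms(2) by auto
  then have "x islimpt S"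
    using assms connected_imp_perfect by (auto simp: is_interval_connected_1)
  then show ?thesis by (simp add: trivial_limit_within)
qed

lemma is_interval_slice:
  assumes "is_interval I" "is_interval J" "p \<in> param_domain I J"
  shows "is_interval (slice (param_domain I J) i p)"
proof -
  have interval: "is_interval (coord_interval I J i)" using assms by (simp add: coord_interval_def)
  show ?thesis
    unfolding slice_param_domain[OF assms(3)] is_interval_1
  proof (intro ballI allI impI)
    fix a b t
    assume "a \<in> {t. p $ i + t \<in> coord_interval I J i}" "b \<in> {t. p $ i + t \<in> coord_interval I J i}"
      "a \<le> t \<and> t \<le> b"
    then show "t \<in> {t. p $ i + t \<in> coord_interval I J i}"
      using interval[unfolded is_interval_1, rule_format, of "p $ i + a" "p $ i + b" "p $ i + t"]
      by simp
  qed
qed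

lemma nondegenerate_param_domain:
  assumes "is_interval I" "interior I \<noteq> {}" "is_interval J" "interior J \<noteq> {}"
  shows "nondegenerate (param_domain I J)"
  unfolding nondegenerate_def
proof (intro ballI allI)
  fix p :: "real^2" and i :: 2
  assume p: "p \<in> param_domain I J"
  let ?K = "coord_interval I J i"
  have translate: "slice (param_domain I J) i p = (+) (- (p $ i)) ` ?K"
    unfolding slice_param_domain[OF p]
  proof
    show "{t. p $ i + t \<in> ?K} \<subseteq> (+) (- (p $ i)) ` ?K"
    proof
      fix t assume "t \<in> {t. p $ i + t \<in> ?K}"
      then have "- (p $ i) + (p $ i + t) \<in> (+) (- (p $ i)) ` ?K" by (intro imageI) simp
      then show "t \<in> (+) (- (p $ i)) ` ?K" by simp
    qed
  qed auto
  have "interior ?K \<noteq> {}" using assms by (simp add: coord_interval_def)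
  then have "interior (slice (param_domain I J) i p) \<noteq> {}"
    by (simp only: translate interior_translation image_is_empty not_False_eq_True)
  then show "at 0 within slice (param_domain I J) i p \<noteq> bot"
    using is_interval_slice[OF assms(1,3) p] zero_in_slice[OF p] at_within_interval_neq_bot by blast
qed

text \<open>Any two points of the rectangle are joined by a horizontal and a vertical segment inside it, and
  the function is constant on each.\<close>
lemma constant_if_partial_derivs_zero:
  fixes \<phi> :: "real^2 \<Rightarrow> 'a::real_normed_vector"
  assumes "is_interval I" "is_interval J"
    and zero: "\<And>i q. q \<in> param_domain I J \<Longrightarrow> has_partial_deriv (param_domain I J) i \<phi> 0 q"
    and p: "p \<in> param_domain I J" and q: "q \<in> param_domain I J"
  shows "\<phi> p = \<phi> q"
proof -
  let ?D = "param_domain I J"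
  have step: "\<phi> (a + t *\<^sub>R axis i 1) = \<phi> a" if "a \<in> ?D" "a + t *\<^sub>R axis i 1 \<in> ?D" for a t i
  proof -
    have "\<exists>c. \<forall>s\<in>slice ?D i a. \<phi> (a + s *\<^sub>R axis i 1) = c"
    proof (rule has_derivative_zero_constant)
      show "convex (slice ?D i a)"
        using is_interval_slice[OF assms(1,2) that(1)] by (rule is_interval_convex)
      show "((\<lambda>s. \<phi> (a + s *\<^sub>R axis i 1)) has_derivative (\<lambda>h. 0)) (at s within slice ?D i a)"
        if "s \<in> slice ?D i a" for s
        using has_partial_deriv_along_slice[OF zero, of a s i] that
        by (simp add: slice_def has_vector_derivative_def)
    qed
    then obtain c where c: "\<And>s. s \<in> slice ?D i a \<Longrightarrow> \<phi> (a + s *\<^sub>R axis i 1) = c" by blast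
    from c[of 0] c[of t] that show ?thesis by (simp add: slice_def)
  qed
  \<comment> \<open>The corner of the path: the first coordinate of \<open>q\<close>, the second of \<open>p\<close>.\<close>
  define m where "m = p + (q $ 1 - p $ 1) *\<^sub>R axis 1 1"
  have m: "m \<in> ?D" using p q by (simp add: m_def param_domain_def axis_def)
  have q_eq: "q = m + (q $ 2 - p $ 2) *\<^sub>R axis 2 1"
    by (simp add: m_def vec_eq_iff forall_2 axis_def)
  have "\<phi> q = \<phi> m" using step[OF m, of "q $ 2 - p $ 2" 2] q q_eq by simp
  moreover have "\<phi> m = \<phi> p" using step[OF p, of "q $ 1 - p $ 1" 1] m by (simp add: m_def)
  ultimately show ?thesis by simp
qed

text \<open>The shape \<open>a(u) A(v) + b(u) B(v)\<close> is common to a meridian surface, its tangent field \<open>z\<^sub>u\<close>, its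
  Gauss map and the partial derivatives of these, so one rule differentiates them all.\<close>
lemma has_partial_deriv_separated:
  fixes A B :: "real \<Rightarrow> 'a::real_normed_vector"
  assumes p: "p \<in> param_domain I J"
    and a: "(a has_vector_derivative a') (at (p $ 1) within I)"
    and b: "(b has_vector_derivative b') (at (p $ 1) within I)"
    and A: "(A has_vector_derivative A') (at (p $ 2) within J)"
    and B: "(B has_vector_derivative B') (at (p $ 2) within J)"
  shows "has_partial_deriv (param_domain I J) i (\<lambda>q. a (q $ 1) *\<^sub>R A (q $ 2) + b (q $ 1) *\<^sub>R B (q $ 2))
    (if i = 1 then a' *\<^sub>R A (p $ 2) + b' *\<^sub>R B (p $ 2) else a (p $ 1) *\<^sub>R A' + b (p $ 1) *\<^sub>R B') p"
proof -
  have u: "has_partial_deriv (param_domain I J) i (\<lambda>q. h (q $ 1)) (if i = 1 then h' else 0) p"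
    if "(h has_vector_derivative h') (at (p $ 1) within I)" for h :: "real \<Rightarrow> real" and h'
  proof (cases "i = 1")
    case True
    then show ?thesis
      using has_vector_derivative_translate[of h h' "p $ 1" 0] that slice_param_domain[OF p]
      by (simp add: has_partial_deriv_def coord_interval_def axis_def)
  qed (simp add: has_partial_deriv_def axis_def)
  have v: "has_partial_deriv (param_domain I J) i (\<lambda>q. h (q $ 2)) (if i = 1 then 0 else h') p"
    if "(h has_vector_derivative h') (at (p $ 2) within J)" for h :: "real \<Rightarrow> 'a" and h'
  proof (cases "i = 1")
    case False
    then have "i = 2" using exhaust_2[of i] by simp
    then show ?thesis
      using has_vector_derivative_translate[of h h' "p $ 2" 0] that slice_param_domain[OF p]
      by (simp add: has_partial_deriv_def coord_interval_def axis_def)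
  qed (simp add: has_partial_deriv_def axis_def)
  show ?thesis
    using has_partial_deriv_add[OF has_partial_deriv_scaleR[OF u[OF a] v[OF A]]
        has_partial_deriv_scaleR[OF u[OF b] v[OF B]]]
    by (cases "i = 1") simp_all
qed

section \<open>Harmonic maps of constant length\<close>

lemma dir_deriv_eq:
  assumes "nondegenerate D" "p \<in> D" "\<And>i. has_partial_deriv D i \<phi> (\<Phi> i) p"
  shows "dir_deriv D X \<phi> p = X p $ 1 *\<^sub>R \<Phi> 1 + X p $ 2 *\<^sub>R \<Phi> 2"
  using partial_deriv_eq[OF assms] by (simp add: dir_deriv_def sum_2)

lemma dir_deriv_zero:
  assumes "nondegenerate D" "p \<in> D" "\<And>q. q \<in> D \<Longrightarrow> \<phi> q = 0"
  shows "dir_deriv D X \<phi> p = 0"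
  using dir_deriv_eq[OF assms(1,2) has_partial_deriv_cong[OF assms(2,3) has_partial_deriv_const]]
  by simp

lemma laplacian_zero_if_partial_derivs_zero:
  assumes D: "nondegenerate D" and p: "p \<in> D"
    and zero: "\<And>i q. q \<in> D \<Longrightarrow> has_partial_deriv D i \<phi> 0 q"
  shows "laplacian D z \<epsilon> \<phi> p = 0"
proof -
  have "dir_deriv D X \<phi> q = 0" if "q \<in> D" for X q
    using dir_deriv_eq[OF D that zero[OF that]] by simp
  moreover from this have "dir_deriv D X (dir_deriv D Y \<phi>) p = 0" for X Y
    by (rule dir_deriv_zero[OF D p])
  ultimately show ?thesis using p by (simp add: laplacian_def)
qed

text \<open>If the component vectors of the frame were dependent, the same dependence would hold between the
  ambient unit vectors \<open>X 1\<close> and \<open>X 2\<close>, which are orthogonal.\<close>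
lemma frame_determinant_nonzero:
  assumes "orthonormal_frame D z \<epsilon>" "p \<in> D"
  shows "\<epsilon> 1 p $ 1 * \<epsilon> 2 p $ 2 - \<epsilon> 1 p $ 2 * \<epsilon> 2 p $ 1 \<noteq> 0"
proof
  define X where "X i = dir_deriv D (\<epsilon> i) z p" for i
  have on: "inner (X i) (X j) = (if i = j then 1 else 0)" for i j
    using assms by (simp add: orthonormal_frame_def X_def)
  have X: "X i = \<epsilon> i p $ 1 *\<^sub>R partial_deriv D 1 z p + \<epsilon> i p $ 2 *\<^sub>R partial_deriv D 2 z p" for i
    by (simp add: X_def dir_deriv_def sum_2)
  assume det: "\<epsilon> 1 p $ 1 * \<epsilon> 2 p $ 2 - \<epsilon> 1 p $ 2 * \<epsilon> 2 p $ 1 = 0"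
  have "\<epsilon> 2 p $ k *\<^sub>R X 1 = \<epsilon> 1 p $ k *\<^sub>R X 2" for k
    using det exhaust_2[of k] by (auto simp: X algebra_simps)
  then have "inner (\<epsilon> 2 p $ k *\<^sub>R X 1) (X 2) = inner (\<epsilon> 1 p $ k *\<^sub>R X 2) (X 2)" for k by simp
  then have "\<epsilon> 1 p $ k = 0" for k by (simp add: on)
  then have "X 1 = 0" by (simp add: X)
  with on[of 1 1] show False by simp
qed

lemma inner_partial_deriv_zero:
  assumes D: "nondegenerate D" and p: "p \<in> D"
    and "\<And>q. q \<in> D \<Longrightarrow> inner (\<phi> q) (\<psi> q) = c"
    and "has_partial_deriv D i \<phi> a p" "has_partial_deriv D i \<psi> b p"
  shows "inner (\<phi> p) b + inner a (\<psi> p) = 0"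
  using has_partial_deriv_unique[OF D p has_partial_deriv_inner[OF assms(4,5)]
      has_partial_deriv_cong[OF p assms(3) has_partial_deriv_const[of D i c p]]] by simp

text \<open>Taking the inner product of the Laplacian with \<open>\<phi>\<close> itself kills the connection term and every
  derivative of the frame, because all of these only contribute first derivatives of \<open>\<phi>\<close>, which are
  orthogonal to \<open>\<phi>\<close>. What remains is the sum of the squared lengths of the frame derivatives of \<open>\<phi>\<close>;
  if it vanishes, so does the derivative in every direction.\<close>
lemma harmonic_constant_length_imp_partial_derivs_zero:
  fixes \<phi> :: "real^2 \<Rightarrow> 'b::real_inner" and z :: "real^2 \<Rightarrow> 'a::real_inner"
  assumes D: "nondegenerate D" and p: "p \<in> D"
    and frame: "orthonormal_frame D z \<epsilon>"
    and d1: "\<And>i q. q \<in> D \<Longrightarrow> has_partial_deriv D i \<phi> (\<Phi> i q) q"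
    and d2: "\<And>i j. \<exists>b. has_partial_deriv D j (\<Phi> i) b p"
    and len: "\<And>q. q \<in> D \<Longrightarrow> inner (\<phi> q) (\<phi> q) = c"
    and harmonic: "laplacian D z \<epsilon> \<phi> p = 0"
  shows "\<Phi> k p = 0"
proof -
  have dphi: "dir_deriv D X \<phi> q = X q $ 1 *\<^sub>R \<Phi> 1 q + X q $ 2 *\<^sub>R \<Phi> 2 q" if "q \<in> D" for X q
    by (rule dir_deriv_eq[OF D that d1[OF that]])
  have orth: "inner (\<phi> q) (\<Phi> i q) = 0" if "q \<in> D" for q i
    using inner_partial_deriv_zero[OF D that len d1[OF that] d1[OF that]]
    by (simp add: inner_commute)
  then have orth_dir: "inner (\<phi> q) (dir_deriv D X \<phi> q) = 0" if "q \<in> D" for q X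
    using that by (simp add: dphi inner_add_right)
  \<comment> \<open>Differentiate \<open>orth_dir\<close> along the frame field. The product rule for \<open>D\<^sub>\<epsilon> \<phi>\<close> supplies the
    existence of its partial derivatives \<open>b j\<close>; \<open>orth_dir\<close> then determines \<open>\<langle>\<phi>, b j\<rangle>\<close>.\<close>
  have second: "inner (\<phi> p) (dir_deriv D (\<epsilon> i) (dir_deriv D (\<epsilon> i) \<phi>) p)
      = - inner (dir_deriv D (\<epsilon> i) \<phi> p) (dir_deriv D (\<epsilon> i) \<phi> p)" for i
  proof -
    let ?\<psi> = "dir_deriv D (\<epsilon> i) \<phi>"
    obtain E where "(\<epsilon> i has_derivative E) (at p within D)"
      using frame p unfolding orthonormal_frame_def differentiable_on_def differentiable_def by blast
    then have comp: "has_partial_deriv D j (\<lambda>q. \<epsilon> i q $ k) (E (axis j 1) $ k) p" for j k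
      using has_partial_deriv_linear[OF bounded_linear_vec_nth has_partial_deriv_of_derivative[OF p]]
      by blast
    have "\<exists>b. has_partial_deriv D j ?\<psi> b p" for j
    proof -
      obtain b1 b2 where "has_partial_deriv D j (\<Phi> 1) b1 p" "has_partial_deriv D j (\<Phi> 2) b2 p"
        using d2 by blast
      note sum = has_partial_deriv_add[OF has_partial_deriv_scaleR[OF comp[where k = 1] this(1)]
          has_partial_deriv_scaleR[OF comp[where k = 2] this(2)]]
      show ?thesis by (rule exI, rule has_partial_deriv_cong[OF p _ sum], rule dphi)
    qed
    then obtain b where b: "\<And>j. has_partial_deriv D j ?\<psi> (b j) p" by metis
    have b_inner: "inner (\<phi> p) (b j) = - inner (\<Phi> j p) (?\<psi> p)" for j
      using inner_partial_deriv_zero[OF D p orth_dir d1[OF p] b, of j] by simp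
    have "inner (\<phi> p) (dir_deriv D (\<epsilon> i) ?\<psi> p)
        = \<epsilon> i p $ 1 * inner (\<phi> p) (b 1) + \<epsilon> i p $ 2 * inner (\<phi> p) (b 2)"
      unfolding dir_deriv_eq[OF D p b] by (simp add: inner_add_right)
    also have "\<dots> = - inner (\<epsilon> i p $ 1 *\<^sub>R \<Phi> 1 p + \<epsilon> i p $ 2 *\<^sub>R \<Phi> 2 p) (?\<psi> p)"
      unfolding b_inner by (simp add: inner_add_left)
    finally show ?thesis unfolding dphi[OF p] .
  qed
  have "inner (\<phi> p) (laplacian D z \<epsilon> \<phi> p) = (\<Sum>i\<in>UNIV. (norm (dir_deriv D (\<epsilon> i) \<phi> p))\<^sup>2)"
    by (simp add: laplacian_def inner_diff_right inner_sum_right sum_2 second orth_dir[OF p]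
        power2_norm_eq_inner inner_add_right)
  with harmonic have "(\<Sum>i\<in>UNIV. (norm (dir_deriv D (\<epsilon> i) \<phi> p))\<^sup>2) = 0" by simp
  then have "dir_deriv D (\<epsilon> i) \<phi> p = 0" for i
    by (simp add: sum_nonneg_eq_0_iff)
  then have zero: "\<epsilon> i p $ 1 *\<^sub>R \<Phi> 1 p + \<epsilon> i p $ 2 *\<^sub>R \<Phi> 2 p = 0" for i
    using dphi[OF p] by simp
  \<comment> \<open>Cramer's rule for the two equations \<open>zero\<close>.\<close>
  let ?det = "\<epsilon> 1 p $ 1 * \<epsilon> 2 p $ 2 - \<epsilon> 1 p $ 2 * \<epsilon> 2 p $ 1"
  have "?det *\<^sub>R \<Phi> 1 p = \<epsilon> 2 p $ 2 *\<^sub>R (\<epsilon> 1 p $ 1 *\<^sub>R \<Phi> 1 p + \<epsilon> 1 p $ 2 *\<^sub>R \<Phi> 2 p)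
      - \<epsilon> 1 p $ 2 *\<^sub>R (\<epsilon> 2 p $ 1 *\<^sub>R \<Phi> 1 p + \<epsilon> 2 p $ 2 *\<^sub>R \<Phi> 2 p)"
    by (simp add: algebra_simps)
  also have "\<dots> = 0" unfolding zero by simp
  finally have "\<Phi> 1 p = 0" using frame_determinant_nonzero[OF frame p] by simp
  have "?det *\<^sub>R \<Phi> 2 p = \<epsilon> 1 p $ 1 *\<^sub>R (\<epsilon> 2 p $ 1 *\<^sub>R \<Phi> 1 p + \<epsilon> 2 p $ 2 *\<^sub>R \<Phi> 2 p)
      - \<epsilon> 2 p $ 1 *\<^sub>R (\<epsilon> 1 p $ 1 *\<^sub>R \<Phi> 1 p + \<epsilon> 1 p $ 2 *\<^sub>R \<Phi> 2 p)"
    by (simp add: algebra_simps)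
  also have "\<dots> = 0" unfolding zero by simp
  finally have "\<Phi> 2 p = 0" using frame_determinant_nonzero[OF frame p] by simp
  with \<open>\<Phi> 1 p = 0\<close> show ?thesis using exhaust_2[of k] by auto
qed

section \<open>Planes\<close>

lemma forall_6: "(\<forall>i::6. P i) \<longleftrightarrow> P 1 \<and> P 2 \<and> P 3 \<and> P 4 \<and> P 5 \<and> P 6"
  using UNIV_6 by (metis UNIV_I empty_iff insert_iff)

lemma bounded_bilinear_wedge: "bounded_bilinear wedge"
  unfolding bilinear_conv_bounded_bilinear[symmetric] bilinear_def
  by (auto intro!: linearI simp: vec_eq_iff forall_6 wedge_nth algebra_simps)

lemmas has_partial_deriv_wedge = has_partial_deriv_bilinear[OF bounded_bilinear_wedge]

lemma wedge_self: "wedge a a = 0"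
  by (simp add: vec_eq_iff wedge_def vector_def)

lemma dim_span_orthonormal_pair:
  fixes x y :: "'a::euclidean_space"
  assumes "inner x x = 1" "inner y y = 1" "inner x y = 0"
  shows "dim (span {x, y}) = 2"
proof -
  have "x \<noteq> y" "0 \<notin> {x, y}" using assms by auto
  moreover have "pairwise orthogonal {x, y}"
    using assms by (simp add: pairwise_insert orthogonal_def inner_commute)
  ultimately have "independent {x, y}" "card {x, y} = 2"
    using pairwise_orthogonal_independent by auto
  then show ?thesis using dim_span_eq_card_independent by metis
qed

lemma orthonormal_pair_expansion:
  fixes x y v :: "'a::euclidean_space"
  assumes "inner x x = 1" "inner y y = 1" "inner x y = 0"
    and "subspace V" "dim V = 2" "x \<in> V" "y \<in> V" "v \<in> V"
  shows "v = inner v x *\<^sub>R x + inner v y *\<^sub>R y"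
proof -
  have "span {x, y} = V"
  proof (rule subspace_dim_equal)
    show "span {x, y} \<subseteq> V" using assms(4,6,7) by (intro span_minimal) auto
    show "dim V \<le> dim (span {x, y})" using dim_span_orthonormal_pair[OF assms(1-3)] assms(5) by simp
  qed (use assms(4) in simp_all)
  then have "v \<in> span {x, y}" using assms(8) by simp
  then obtain a b where "v = a *\<^sub>R x + b *\<^sub>R y"
    by (auto simp: span_insert span_singleton algebra_simps)
  then show ?thesis using assms(1-3) inner_commute[of y x] by (simp add: inner_add_left)
qed

text \<open>Contracting \<open>x \<and> y\<close> with \<open>w\<close> gives \<open>\<langle>w, x\<rangle> y - \<langle>w, y\<rangle> x\<close>, which vanishes exactly when \<open>w\<close> is
  orthogonal to \<open>x\<close> and \<open>y\<close>. Since the bivector is constant, the normal vectors at \<open>p0\<close> are normal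
  everywhere, and the surface has constant height over the tangent plane at \<open>p0\<close>.\<close>
lemma planar_if_wedge_constant:
  fixes z x y :: "real^2 \<Rightarrow> real^4"
  assumes IJ: "is_interval I" "is_interval J" and p0: "p0 \<in> param_domain I J"
    and z: "\<And>i q. q \<in> param_domain I J \<Longrightarrow> has_partial_deriv (param_domain I J) i z (Z i q) q"
    and tangent: "\<And>i q. q \<in> param_domain I J \<Longrightarrow> Z i q \<in> span {x q, y q}"
    and on: "\<And>q. q \<in> param_domain I J \<Longrightarrow>
      inner (x q) (x q) = 1 \<and> inner (y q) (y q) = 1 \<and> inner (x q) (y q) = 0"
    and const: "\<And>q. q \<in> param_domain I J \<Longrightarrow> wedge (x q) (y q) = wedge (x p0) (y p0)"
  shows "\<exists>P. affine P \<and> aff_dim P = 2 \<and> z ` param_domain I J \<subseteq> P"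
proof -
  let ?D = "param_domain I J"
  let ?V = "span {x p0, y p0}"
  have height: "inner w (z q) = inner w (z p0)"
    if w: "inner w (x p0) = 0" "inner w (y p0) = 0" and q: "q \<in> ?D" for w q
  proof (rule constant_if_partial_derivs_zero[OF IJ _ q p0])
    fix i s assume s: "s \<in> ?D"
    \<comment> \<open>The pairing with \<open>w \<and> b\<close> is the \<open>b\<close>-component of the contraction with \<open>w\<close>.\<close>
    have contraction: "inner (wedge w b) (wedge (x s) (y s)) = 0" for b
      unfolding const[OF s] inner_wedge using w by simp
    have "inner w (x s) = 0" using contraction[of "y s"] on[OF s] inner_commute[of "y s" "x s"]
      by (simp add: inner_wedge)
    moreover have "inner w (y s) = 0"
      using contraction[of "x s"] on[OF s] by (simp add: inner_wedge)
    ultimately have "inner w (Z i s) = 0"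
      using tangent[OF s, of i] orthogonal_to_span[of "Z i s" "{x s, y s}" w]
      by (auto simp: orthogonal_def)
    then show "has_partial_deriv ?D i (\<lambda>q. inner w (z q)) 0 s"
      using has_partial_deriv_linear[OF bounded_linear_inner_right z[OF s, of i], of w] by simp
  qed
  have "z q - z p0 \<in> ?V" if q: "q \<in> ?D" for q
  proof -
    define d where "d = z q - z p0"
    \<comment> \<open>The component of \<open>d\<close> normal to the tangent plane at \<open>p0\<close>; it is to be shown zero.\<close>
    define w where "w = d - (inner d (x p0) *\<^sub>R x p0 + inner d (y p0) *\<^sub>R y p0)"
    have w: "inner w (x p0) = 0" "inner w (y p0) = 0"
      using on[OF p0] inner_commute[of "y p0" "x p0"]
      by (simp_all add: w_def inner_diff_left inner_add_left)
    have "inner w d = 0" using height[OF w q] by (simp add: d_def inner_diff_right)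
    moreover have "inner w (inner d (x p0) *\<^sub>R x p0 + inner d (y p0) *\<^sub>R y p0) = 0"
      using w by (simp add: inner_add_right)
    ultimately have "inner w w = 0"
      by (subst (2) w_def) (simp add: inner_diff_right)
    then have "d = inner d (x p0) *\<^sub>R x p0 + inner d (y p0) *\<^sub>R y p0" by (simp add: w_def)
    also have "\<dots> \<in> ?V" by (intro span_add span_scale span_base) auto
    finally show ?thesis by (simp add: d_def)
  qed
  then have "z p0 + (z q - z p0) \<in> (+) (z p0) ` ?V" if "q \<in> ?D" for q
    using that by (intro imageI)
  then have "z ` ?D \<subseteq> (+) (z p0) ` ?V" by auto
  moreover have "affine ((+) (z p0) ` ?V)"
    using affine_translation subspace_imp_affine subspace_span by blast
  moreover have "aff_dim ((+) (z p0) ` ?V) = 2"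
    using dim_span_orthonormal_pair[of "x p0" "y p0"] on[OF p0]
    by (simp add: aff_dim_translation_eq aff_dim_subspace)
  ultimately show ?thesis by blast
qed

text \<open>Inside the plane \<open>V\<close> an orthonormal frame can only rotate: the derivative of \<open>x\<close> is a multiple of
  \<open>y\<close> and vice versa, so \<open>x' \<and> y\<close> and \<open>x \<and> y'\<close> both vanish.\<close>
lemma wedge_partial_derivs_zero_in_plane:
  fixes x y :: "real^2 \<Rightarrow> real^4"
  assumes D: "nondegenerate D" and p: "p \<in> D" and V: "subspace V" "dim V = 2"
    and mem: "\<And>q. q \<in> D \<Longrightarrow> x q \<in> V \<and> y q \<in> V"
    and on: "\<And>q. q \<in> D \<Longrightarrow>
      inner (x q) (x q) = 1 \<and> inner (y q) (y q) = 1 \<and> inner (x q) (y q) = 0"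
    and x: "has_partial_deriv D i x x' p" and y: "has_partial_deriv D i y y' p"
  shows "has_partial_deriv D i (\<lambda>q. wedge (x q) (y q)) 0 p"
proof -
  have "x' \<in> V" "y' \<in> V"
    using has_partial_deriv_in_subspace[OF D p V(1)] mem x y by blast+
  then have "x' = inner x' (x p) *\<^sub>R x p + inner x' (y p) *\<^sub>R y p"
    "y' = inner y' (x p) *\<^sub>R x p + inner y' (y p) *\<^sub>R y p"
    using orthonormal_pair_expansion[OF _ _ _ V] on[OF p] mem[OF p] by blast+
  moreover have "inner x' (x p) = 0" "inner y' (y p) = 0"
    using inner_partial_deriv_zero[OF D p _ x x, of 1] inner_partial_deriv_zero[OF D p _ y y, of 1] on
    by (simp_all add: inner_commute)
  ultimately have *: "x' = inner x' (y p) *\<^sub>R y p" "y' = inner y' (x p) *\<^sub>R x p" by simp_all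
  interpret bounded_bilinear wedge by (rule bounded_bilinear_wedge)
  have "wedge (x p) y' = 0" "wedge x' (y p) = 0"
    by (subst *, simp add: scaleR_left scaleR_right wedge_self)+
  with has_partial_deriv_wedge[OF x y] show ?thesis by simp
qed

section \<open>Meridian surfaces\<close>

lemma meridian_surface_has_partial_deriv:
  assumes p: "p \<in> param_domain I J"
    and f: "(f has_vector_derivative f') (at (p $ 1) within I)"
    and g: "(g has_vector_derivative g') (at (p $ 1) within I)"
    and r: "(r has_vector_derivative r') (at (p $ 2) within J)"
  shows "has_partial_deriv (param_domain I J) i (meridian_surface f g r)
    (if i = 1 then f' *\<^sub>R r (p $ 2) + g' *\<^sub>R axis 4 1 else f (p $ 1) *\<^sub>R r') p"
proof -
  have "meridian_surface f g r = (\<lambda>q. f (q $ 1) *\<^sub>R r (q $ 2) + g (q $ 1) *\<^sub>R axis 4 1)"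
    by (simp add: fun_eq_iff meridian_surface_def)
  then show ?thesis
    using has_partial_deriv_separated[OF p f g r has_vector_derivative_const, of i "axis 4 1"]
    by (cases "i = 1") simp_all
qed

lemma inner_derivative_zero:
  fixes a b :: "real \<Rightarrow> 'a::real_inner"
  assumes "at v within J \<noteq> bot" "v \<in> J" "\<And>t. t \<in> J \<Longrightarrow> inner (a t) (b t) = c"
    and "(a has_vector_derivative a') (at v within J)" "(b has_vector_derivative b') (at v within J)"
  shows "inner (a v) b' + inner a' (b v) = 0"
proof (rule vector_derivative_unique_within[OF assms(1)])
  show "((\<lambda>t. inner (a t) (b t)) has_vector_derivative inner (a v) b' + inner a' (b v)) (at v within J)"
    by (rule bounded_bilinear.has_vector_derivative[OF bounded_bilinear_inner assms(4,5)])
  show "((\<lambda>t. inner (a t) (b t)) has_vector_derivative 0) (at v within J)"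
    by (rule has_vector_derivative_transform[OF assms(2,3) has_vector_derivative_const])
qed

text \<open>The relations that make \<open>f' r + g' e\<^sub>4\<close> and \<open>r'\<close> orthonormal when \<open>f'\<^sup>2 + g'\<^sup>2 = 1\<close>.
  Orthogonality to \<open>r'\<close> comes from differentiating \<open>\<langle>r, r\<rangle> = 1\<close> and \<open>\<langle>r, e\<^sub>4\<rangle> = 0\<close>.\<close>
lemma spherical_curve_frame:
  fixes r :: "real \<Rightarrow> real^4"
  assumes v: "v \<in> J" "at v within J \<noteq> bot"
    and sphere: "\<And>t. t \<in> J \<Longrightarrow> r t \<in> sphere 0 1 \<inter> span {axis 1 1, axis 2 1, axis 3 1}"
    and r: "(r has_vector_derivative r') (at v within J)" and unit: "norm r' = 1"
  shows "inner (r v) (r v) = 1" "inner r' r' = 1" "inner (r v) r' = 0"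
    "inner (r v) (axis 4 1) = 0" "inner (axis 4 1) r' = 0"
proof -
  have len: "inner (r t) (r t) = 1" if "t \<in> J" for t
    using sphere[OF that] by (simp add: dot_square_norm)
  have "orthogonal (axis 4 1) (r t)" if "t \<in> J" for t
    by (rule orthogonal_to_span[of _ "{axis 1 1, axis 2 1, axis 3 1}"])
       (use sphere[OF that] in \<open>auto simp: orthogonal_def inner_axis_axis\<close>)
  then have e4: "inner (r t) (axis 4 1) = 0" if "t \<in> J" for t
    using that by (simp add: orthogonal_def inner_commute)
  show "inner (r v) (r v) = 1" "inner (r v) (axis 4 1) = 0" using v len e4 by blast+
  show "inner r' r' = 1" using unit by (simp add: dot_square_norm)
  show "inner (r v) r' = 0"
    using inner_derivative_zero[OF v(2,1) len r r] by (simp add: inner_commute)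
  show "inner (axis 4 1) r' = 0"
    using inner_derivative_zero[OF v(2,1) e4 r has_vector_derivative_const]
    by (simp add: inner_commute)
qed

theorem theorem3p2:
  fixes I J :: "real set" and f g :: "real \<Rightarrow> real" and r :: "real \<Rightarrow> real^4"
    and \<epsilon> :: "2 \<Rightarrow> real^2 \<Rightarrow> real^2"
  assumes "is_interval I" and "interior I \<noteq> {}"
    and "is_interval J" and "interior J \<noteq> {}"
    and "smooth_on_interval r J"
    and "\<And>v. v \<in> J \<Longrightarrow> r v \<in> sphere 0 1 \<inter> span {axis 1 1, axis 2 1, axis 3 1}"
    and "\<And>v. v \<in> J \<Longrightarrow> norm (vector_derivative r (at v within J)) = 1"
    and "smooth_on_interval f I" and "smooth_on_interval g I"
    and "\<And>u. u \<in> I \<Longrightarrow> f u \<noteq> 0" and "\<exists>u\<in>I. g u \<noteq> 0"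
    and "\<And>u. u \<in> I \<Longrightarrow>
           (vector_derivative f (at u within I))\<^sup>2 + (vector_derivative g (at u within I))\<^sup>2 = 1"
    and "orthonormal_frame (param_domain I J) (meridian_surface f g r) \<epsilon>"
  shows "(\<forall>p \<in> param_domain I J.
            laplacian (param_domain I J) (meridian_surface f g r) \<epsilon> (gauss_map I J f g r) p = 0)
         \<longleftrightarrow>
         (\<exists>P :: (real^4) set. affine P \<and> aff_dim P = 2 \<and>
            meridian_surface f g r ` param_domain I J \<subseteq> P)"
    (is "?harmonic \<longleftrightarrow> ?planar")
proof -
  let ?D = "param_domain I J"
  let ?z = "meridian_surface f g r"
  let ?G = "gauss_map I J f g r"
  have D: "nondegenerate ?D" by (rule nondegenerate_param_domain[OF assms(1-4)])
  have mem: "q $ 1 \<in> I" "q $ 2 \<in> J" if "q \<in> ?D" for q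
    using that by (simp_all add: param_domain_def)
  obtain p0 where p0: "p0 \<in> ?D"
  proof -
    obtain u v where "u \<in> I" "v \<in> J" using assms(2,4) interior_subset by blast
    then have "vector [u, v] \<in> ?D" by (simp add: param_domain_def)
    then show ?thesis by (rule that)
  qed
  obtain df where df: "df 0 = f"
    "\<And>n t. t \<in> I \<Longrightarrow> (df n has_vector_derivative df (Suc n) t) (at t within I)"
    using assms(8) unfolding smooth_on_interval_def by metis
  obtain dg where dg: "dg 0 = g"
    "\<And>n t. t \<in> I \<Longrightarrow> (dg n has_vector_derivative dg (Suc n) t) (at t within I)"
    using assms(9) unfolding smooth_on_interval_def by metis
  obtain dr where dr: "dr 0 = r"
    "\<And>n t. t \<in> J \<Longrightarrow> (dr n has_vector_derivative dr (Suc n) t) (at t within J)"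
    using assms(5) unfolding smooth_on_interval_def by metis
  have f1: "(f has_vector_derivative df 1 u) (at u within I)"
    and g1: "(g has_vector_derivative dg 1 u) (at u within I)" if "u \<in> I" for u
    using df(2)[OF that, of 0] dg(2)[OF that, of 0] df(1) dg(1) by simp_all
  have r1: "(r has_vector_derivative dr 1 v) (at v within J)" if "v \<in> J" for v
    using dr(2)[OF that, of 0] dr(1) by simp
  have speed: "(df 1 u)\<^sup>2 + (dg 1 u)\<^sup>2 = 1" if "u \<in> I" for u
    using assms(12)[OF that] vector_derivative_within[OF _ f1[OF that]]
      vector_derivative_within[OF _ g1[OF that]]
      at_within_interval_neq_bot[OF assms(1,2) that] by simp
  have curve: "inner (r v) (r v) = 1" "inner (dr 1 v) (dr 1 v) = 1" "inner (r v) (dr 1 v) = 0"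
    "inner (r v) (axis 4 1) = 0" "inner (axis 4 1) (dr 1 v) = 0" if "v \<in> J" for v
  proof -
    have nb: "at v within J \<noteq> bot" by (rule at_within_interval_neq_bot[OF assms(3,4) that])
    have "norm (dr 1 v) = 1"
      using assms(7)[OF that] vector_derivative_within[OF nb r1[OF that]] by simp
    note spherical_curve_frame[OF that nb assms(6) r1[OF that] this]
    then show "inner (r v) (r v) = 1" "inner (dr 1 v) (dr 1 v) = 1" "inner (r v) (dr 1 v) = 0"
      "inner (r v) (axis 4 1) = 0" "inner (axis 4 1) (dr 1 v) = 0" by auto
  qed
  define x where "x q = df 1 (q $ 1) *\<^sub>R r (q $ 2) + dg 1 (q $ 1) *\<^sub>R axis 4 1" for q :: "real^2"
  define y where "y q = dr 1 (q $ 2)" for q :: "real^2"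
  have on: "inner (x q) (x q) = 1 \<and> inner (y q) (y q) = 1 \<and> inner (x q) (y q) = 0"
    if "q \<in> ?D" for q
  proof -
    have e4: "inner (axis 4 1 :: real^4) (axis 4 1) = 1" by (simp add: inner_axis_axis)
    have "inner (axis 4 1) (r (q $ 2)) = 0" using curve(4)[OF mem(2)[OF that]]
      by (simp add: inner_commute)
    then show ?thesis
      using curve[OF mem(2)[OF that]] speed[OF mem(1)[OF that]]
      by (simp add: x_def y_def inner_add_left inner_add_right e4 power2_eq_square
          del: inner_axis inner_axis')
  qed
  define Z where "Z i q = (if i = 1 then x q else f (q $ 1) *\<^sub>R y q)" for i :: 2 and q
  have z: "has_partial_deriv ?D i ?z (Z i q) q" if "q \<in> ?D" for i q
    using meridian_surface_has_partial_deriv[OF that f1 g1 r1, of i] mem[OF that]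
    by (cases "i = 1") (simp_all add: Z_def x_def y_def)
  have G: "?G q = wedge (x q) (y q)" if "q \<in> ?D" for q
    using partial_deriv_eq[OF D that z[OF that]] assms(10)[OF mem(1)[OF that]]
    by (simp add: gauss_map_def Z_def)
  show ?thesis
  proof
    assume harmonic: ?harmonic
    \<comment> \<open>\<open>G = f' A + g' B\<close> with \<open>A = r \<and> r'\<close> and \<open>B = e\<^sub>4 \<and> r'\<close>. The derivatives of \<open>A\<close> and \<open>B\<close> have
      a single term, as \<open>r' \<and> r' = 0\<close> and \<open>e\<^sub>4\<close> is constant.\<close>
    define A where "A v = wedge (r v) (dr 1 v)" for v
    define B where "B v = wedge (axis 4 1) (dr 1 v)" for v
    define A1 where "A1 v = wedge (r v) (dr 2 v)" for v
    define B1 where "B1 v = wedge (axis 4 1) (dr 2 v)" for v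
    interpret W: bounded_bilinear wedge by (rule bounded_bilinear_wedge)
    have G_split: "?G q = df 1 (q $ 1) *\<^sub>R A (q $ 2) + dg 1 (q $ 1) *\<^sub>R B (q $ 2)"
      if "q \<in> ?D" for q
      using G[OF that] by (simp add: x_def y_def A_def B_def W.add_left W.scaleR_left)
    have dr2: "(dr 1 has_vector_derivative dr 2 v) (at v within J)"
      "(dr 2 has_vector_derivative dr 3 v) (at v within J)" if "v \<in> J" for v
      using dr(2)[OF that, of 1] dr(2)[OF that, of 2] by (simp_all add: numeral_eq_Suc)
    have dA: "(A has_vector_derivative A1 v) (at v within J)"
      "(B has_vector_derivative B1 v) (at v within J)"
      "(A1 has_vector_derivative wedge (r v) (dr 3 v) + wedge (dr 1 v) (dr 2 v)) (at v within J)"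
      "(B1 has_vector_derivative wedge (axis 4 1) (dr 3 v)) (at v within J)" if "v \<in> J" for v
      unfolding A_def B_def A1_def B1_def
      using W.has_vector_derivative[OF r1 dr2(1), OF that that]
        W.has_vector_derivative[OF r1 dr2(2), OF that that]
        W.has_vector_derivative[OF has_vector_derivative_const dr2(1)[OF that], of "axis 4 1"]
        W.has_vector_derivative[OF has_vector_derivative_const dr2(2)[OF that], of "axis 4 1"]
      by (simp_all add: wedge_self W.zero_left)
    define \<Phi> where "\<Phi> i q = (if i = 1 then df 2 (q $ 1) *\<^sub>R A (q $ 2) + dg 2 (q $ 1) *\<^sub>R B (q $ 2)
      else df 1 (q $ 1) *\<^sub>R A1 (q $ 2) + dg 1 (q $ 1) *\<^sub>R B1 (q $ 2))" for i :: 2 and q :: "real^2"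
    have dfg: "(df n has_vector_derivative df (Suc n) u) (at u within I)"
      "(dg n has_vector_derivative dg (Suc n) u) (at u within I)" if "u \<in> I" for n u
      using df(2) dg(2) that by blast+
    have G1: "has_partial_deriv ?D i ?G (\<Phi> i q) q" if "q \<in> ?D" for i q
      using has_partial_deriv_cong[OF that G_split has_partial_deriv_separated[OF that
            dfg[OF mem(1)[OF that]] dA(1,2)[OF mem(2)[OF that]]], of i]
      by (cases "i = 1") (simp_all add: \<Phi>_def numeral_2_eq_2)
    have G2: "\<exists>b. has_partial_deriv ?D j (\<Phi> i) b q" if "q \<in> ?D" for i j q
    proof (cases "i = 1")
      case True
      have split: "\<Phi> i = (\<lambda>q. df 2 (q $ 1) *\<^sub>R A (q $ 2) + dg 2 (q $ 1) *\<^sub>R B (q $ 2))"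
        using True by (simp add: \<Phi>_def fun_eq_iff)
      show ?thesis
        unfolding split
        by (rule exI, rule has_partial_deriv_separated[OF that dfg[OF mem(1)[OF that]]
              dA(1,2)[OF mem(2)[OF that]]])
    next
      case False
      have split: "\<Phi> i = (\<lambda>q. df 1 (q $ 1) *\<^sub>R A1 (q $ 2) + dg 1 (q $ 1) *\<^sub>R B1 (q $ 2))"
        using False by (simp add: \<Phi>_def fun_eq_iff)
      show ?thesis
        unfolding split
        by (rule exI, rule has_partial_deriv_separated[OF that dfg[OF mem(1)[OF that]]
              dA(3,4)[OF mem(2)[OF that]]])
    qed
    have unit: "inner (?G q) (?G q) = 1" if "q \<in> ?D" for q
      using on[OF that] by (simp add: G[OF that] inner_wedge inner_commute)
    have "\<Phi> i q = 0" if "q \<in> ?D" for i q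
      using harmonic_constant_length_imp_partial_derivs_zero[OF D that assms(13) G1 G2[OF that] unit]
        harmonic that by blast
    then have "has_partial_deriv ?D i ?G 0 q" if "q \<in> ?D" for i q
      using G1[OF that, of i] that by simp
    then have "?G q = ?G p0" if "q \<in> ?D" for q
      by (rule constant_if_partial_derivs_zero[OF assms(1,3) _ that p0])
    then have const: "wedge (x q) (y q) = wedge (x p0) (y p0)" if "q \<in> ?D" for q
      using that by (simp add: G[OF that, symmetric] G[OF p0, symmetric])
    have "Z i q \<in> span {x q, y q}" for i q
      by (simp add: Z_def span_base span_scale)
    from planar_if_wedge_constant[OF assms(1,3) p0 z this on const] show ?planar by blast
  next
    assume ?planar
    then obtain P where P: "affine P" "aff_dim P = 2" "?z ` ?D \<subseteq> P" by blast
    \<comment> \<open>The direction space of \<open>P\<close>.\<close>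
    define V where "V = (\<lambda>a. a - ?z p0) ` P"
    have V: "subspace V"
      unfolding V_def by (rule affine_diffs_subspace_subtract) (use P p0 in auto)
    have "aff_dim V = 2" using P(2) by (simp add: V_def aff_dim_translation_eq_subtract)
    then have dimV: "dim V = 2" using aff_dim_subspace[OF V] by simp
    have Z: "Z i q \<in> V" if "q \<in> ?D" for i q
    proof (rule has_partial_deriv_in_subspace[OF D that V])
      show "has_partial_deriv ?D i (\<lambda>q. ?z q + (- ?z p0)) (Z i q) q"
        using has_partial_deriv_add[OF z[OF that] has_partial_deriv_const[of ?D i "- ?z p0"]] by simp
      show "?z s + (- ?z p0) \<in> V" if "s \<in> ?D" for s
        using P(3) that by (auto simp: V_def)
    qed
    have xyV: "x q \<in> V \<and> y q \<in> V" if "q \<in> ?D" for q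
    proof -
      have "(1 / f (q $ 1)) *\<^sub>R Z 2 q \<in> V" by (rule subspace_scale[OF V Z[OF that]])
      then show ?thesis
        using Z[OF that, of 1] assms(10)[OF mem(1)[OF that]] by (simp add: Z_def)
    qed
    have "has_partial_deriv ?D i ?G 0 q" if "q \<in> ?D" for i q
    proof -
      have f2: "(df 1 has_vector_derivative df 2 (q $ 1)) (at (q $ 1) within I)"
        and g2: "(dg 1 has_vector_derivative dg 2 (q $ 1)) (at (q $ 1) within I)"
        and r2: "(dr 1 has_vector_derivative dr 2 (q $ 2)) (at (q $ 2) within J)"
        using df(2)[of "q $ 1" 1] dg(2)[of "q $ 1" 1] dr(2)[of "q $ 2" 1] mem[OF that]
        by (simp_all add: numeral_2_eq_2)
      have "\<exists>x'. has_partial_deriv ?D i x x' q"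
        unfolding x_def
        by (rule exI, rule has_partial_deriv_separated[OF that f2 g2 r1[OF mem(2)[OF that]]
              has_vector_derivative_const])
      moreover have "\<exists>y'. has_partial_deriv ?D i y y' q"
        using has_partial_deriv_separated[OF that has_vector_derivative_const[of 1]
            has_vector_derivative_const[of 0] r2 r2, of i]
        by (auto simp: y_def[abs_def])
      ultimately obtain x' y' where "has_partial_deriv ?D i x x' q" "has_partial_deriv ?D i y y' q"
        by blast
      note flat = wedge_partial_derivs_zero_in_plane[OF D that V dimV xyV on this]
      show ?thesis by (rule has_partial_deriv_cong[OF that _ flat], rule G)
    qed
    then show ?harmonic using laplacian_zero_if_partial_derivs_zero[OF D] by blast
  qed
qed

end
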